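(* Let $(X,\Sigma)$ be a measurable space and let $\Omega=X^{\mathbf{N}}$, with the deletion transformations $s_i\colon\Omega\to\Omega$, $i\in\mathbf{N}$. Every invariant ergodic probability measure $\mu$ on $\Omega$ is IID, i.e. there exists a probability measure $\eta$ on $(X,\Sigma)$ such that $\mu=\eta^{\mathbf{N}}$.
   Context: $\mathbf{N}=\{1,2,\ldots\}$ and $\Omega=X^{\mathbf{N}}$ carries the product $\sigma$-algebra. For $i\in\mathbf{N}$ the transformation $s_i$ deletes the $i$th coordinate: $[s_i\omega]_n=\omega_n$ if $n<i$ and $[s_i\omega]_n=\omega_{n+1}$ otherwise. A probability measure $\mu$ on $\Omega$ is invariant if $\mu(s_i^{-1}E)=\mu(E)$ for every measurable $E\subseteq\Omega$ and every $i\in\mathbf{N}$. It is ergodic if $\mu(E)\in\{0,1\}$ for every measurable $E\subseteq\Omega$ such that $s_i^{-1}E=E$ for all $i\in\mathbf{N}$. *)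

theory Defs
  imports "HOL-Probability.Probability"
begin

text \<open>
  A measurable space \<open>(X, \<Sigma>)\<close> is a value \<open>M :: 'a measure\<close> of which only \<open>space M\<close> and
  \<open>sets M\<close> are used. Coordinates are numbered from 0 instead of from 1, so
  \<open>deletion i\<close> removes coordinate \<open>i\<close> for every \<open>i \<ge> 0\<close>.
\<close>

definition seq_space :: "'a measure \<Rightarrow> (nat \<Rightarrow> 'a) measure" where
  "seq_space M = (\<Pi>\<^sub>M n\<in>UNIV. M)"

definition deletion :: "nat \<Rightarrow> (nat \<Rightarrow> 'a) \<Rightarrow> (nat \<Rightarrow> 'a)" where
  "deletion i \<omega> = (\<lambda>n. if n < i then \<omega> n else \<omega> (Suc n))"

definition prob_measure_on :: "'a measure \<Rightarrow> 'a measure \<Rightarrow> bool" where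
  "prob_measure_on M \<mu> \<longleftrightarrow> sets \<mu> = sets M \<and> prob_space \<mu>"

text \<open>
  Preimages are taken inside \<open>space (seq_space M)\<close>, which is in general a proper subset
  of the function type.
\<close>

definition deletion_invariant :: "'a measure \<Rightarrow> (nat \<Rightarrow> 'a) measure \<Rightarrow> bool" where
  "deletion_invariant M \<mu> \<longleftrightarrow>
    (\<forall>i. \<forall>E\<in>sets (seq_space M).
       emeasure \<mu> (deletion i -` E \<inter> space (seq_space M)) = emeasure \<mu> E)"

definition deletion_ergodic :: "'a measure \<Rightarrow> (nat \<Rightarrow> 'a) measure \<Rightarrow> bool" where
  "deletion_ergodic M \<mu> \<longleftrightarrow>
    (\<forall>E\<in>sets (seq_space M).
       (\<forall>i. deletion i -` E \<inter> space (seq_space M) = E) \<longrightarrow> emeasure \<mu> E \<in> {0, 1})"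

definition IID :: "'a measure \<Rightarrow> (nat \<Rightarrow> 'a) measure \<Rightarrow> bool" where
  "IID M \<mu> \<longleftrightarrow> (\<exists>\<eta>. prob_measure_on M \<eta> \<and> \<mu> = (\<Pi>\<^sub>M n\<in>UNIV. \<eta>))"

end

(* By invariance, deleting coordinate k repeatedly shows that E[g 1_A(omega_k)] = E[g 1_A(omega_n)]
   for all n >= k whenever g depends only on the coordinates below k. The covariance of
   1_A(omega_m) and 1_A(omega_n) is therefore the same for all m < n, which bounds the L1 distance
   of the averages over m and over N >= m indicators by m^(-1/2); along m = 4^j they converge almost
   surely. The limit is invariant under deletions, since deleting one coordinate changes an average
   by at most 1/m, so by ergodicity it is almost surely the constant mu(omega_0 in A). Averaging
   E[g 1_A(omega_n)] over n thus gives E[g 1_A(omega_k)] = E[g] mu(omega_0 in A), and induction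
   over k yields the product formula on cylinders. *)
theory Submission
  imports Defs
begin

section \<open>Measurability of deletions and general facts about limits\<close>

lemma measurable_deletion: "deletion i \<in> seq_space M \<rightarrow>\<^sub>M seq_space M"
  unfolding seq_space_def deletion_def[abs_def]
  by (rule measurable_PiM_single') (auto simp: space_PiM PiE_iff)

text \<open>Both sequences have exactly the same limits, so the description operator behind
  \<open>lim\<close> yields the same value, even when neither sequence converges.\<close>

lemma lim_cong_diff_tendsto_zero:
  fixes X Y :: "nat \<Rightarrow> 'b::real_normed_vector"
  assumes "(\<lambda>n. X n - Y n) \<longlonglongrightarrow> 0"
  shows "lim X = lim Y"
  unfolding lim_def using Lim_transform_eq[OF assms] by simp

text \<open>For each threshold \<open>q\<close>, the variable lies almost surely on one side of
  \<open>q\<close>, and its expectation then lies on the same side. The rational thresholds share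
  one null set, and a rational strictly between \<open>Z x\<close> and the expectation would
  contradict this.\<close>

lemma (in prob_space) AE_eq_expectation_if_zero_one:
  fixes Z :: "'a \<Rightarrow> real"
  assumes Z: "integrable M Z"
    and zero_one: "\<And>q. prob {x \<in> space M. Z x \<le> q} \<in> {0, 1}"
  shows "AE x in M. Z x = expectation Z"
proof -
  have [measurable]: "Z \<in> borel_measurable M" using Z by auto
  have *: "AE x in M. (Z x \<le> q \<longrightarrow> expectation Z \<le> q) \<and> (q < Z x \<longrightarrow> q \<le> expectation Z)" for q
  proof (cases "prob {x \<in> space M. Z x \<le> q} = 0")
    case True
    then have gt: "AE x in M. q < Z x"
      by (subst (asm) prob_eq_0) (auto simp: not_le)
    then have "q \<le> expectation Z"
      using Z by (intro integral_ge_const) (auto elim: eventually_mono)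
    with gt show ?thesis by (intro eventually_mono[OF gt]) auto
  next
    case False
    then have "prob {x \<in> space M. Z x \<le> q} = 1" using zero_one[of q] by auto
    then have le: "AE x in M. Z x \<le> q" by (subst (asm) prob_eq_1) auto
    then have "expectation Z \<le> q"
      using Z by (intro integral_le_const) auto
    with le show ?thesis by (intro eventually_mono[OF le]) auto
  qed
  have "AE x in M. \<forall>q::rat. (Z x \<le> of_rat q \<longrightarrow> expectation Z \<le> of_rat q) \<and>
      (of_rat q < Z x \<longrightarrow> of_rat q \<le> expectation Z)"
    using * by (subst AE_all_countable) blast
  then show ?thesis
  proof eventually_elim
    case (elim x)
    show ?case
    proof (rule linorder_cases[of "Z x" "expectation Z"])
      assume "Z x < expectation Z"
      then obtain q where "Z x < of_rat q" "of_rat q < expectation Z"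
        using of_rat_dense by blast
      then show ?thesis using elim[rule_format, of q] by linarith
    next
      assume "expectation Z < Z x"
      then obtain q where "expectation Z < of_rat q" "of_rat q < Z x"
        using of_rat_dense by blast
      then show ?thesis using elim[rule_format, of q] by linarith
    qed
  qed
qed

text \<open>The sum of the absolute increments has finite integral, so it is finite almost surely;
  there the increments are summable, and they telescope to the sequence.\<close>

lemma (in prob_space) AE_convergent_if_summable_L1:
  fixes X :: "nat \<Rightarrow> 'a \<Rightarrow> real"
  assumes X: "\<And>n. integrable M (X n)"
    and sum: "summable (\<lambda>n. expectation (\<lambda>x. \<bar>X (Suc n) x - X n x\<bar>))"
  shows "AE x in M. convergent (\<lambda>n. X n x)"
proof -
  let ?D = "\<lambda>n x. \<bar>X (Suc n) x - X n x\<bar>"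
  have [measurable]: "X n \<in> borel_measurable M" for n using X by auto
  have D: "integrable M (?D n)" for n using X by auto
  have "(\<integral>\<^sup>+x. (\<Sum>n. ennreal (?D n x)) \<partial>M) = (\<Sum>n. \<integral>\<^sup>+x. ennreal (?D n x) \<partial>M)"
    by (rule nn_integral_suminf) measurable
  also have "\<dots> = (\<Sum>n. ennreal (expectation (?D n)))"
    using D by (subst nn_integral_eq_integral) auto
  also have "\<dots> = ennreal (\<Sum>n. expectation (?D n))"
    by (rule suminf_ennreal2[OF _ sum]) auto
  finally have "(\<integral>\<^sup>+x. (\<Sum>n. ennreal (?D n x)) \<partial>M) \<noteq> \<infinity>" by simp
  then have "AE x in M. (\<Sum>n. ennreal (?D n x)) \<noteq> \<infinity>"
    by (intro nn_integral_PInf_AE) auto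
  then show ?thesis
  proof eventually_elim
    case (elim x)
    then have "summable (\<lambda>n. ?D n x)"
      by (intro summable_suminf_not_top) auto
    then have "summable (\<lambda>n. X (Suc n) x - X n x)"
      by (rule summable_rabs_cancel)
    then have "convergent (\<lambda>m. \<Sum>n<m. X (Suc n) x - X n x)"
      by (simp add: summable_iff_convergent)
    then have "convergent (\<lambda>m. X m x - X 0 x)"
      by (subst (asm) sum_lessThan_telescope)
    then have "convergent (\<lambda>m. X m x - X 0 x + X 0 x)"
      by (intro convergent_add convergent_const)
    then show ?case by simp
  qed
qed

section \<open>Indicators, empirical frequencies and the effect of one deletion\<close>

definition hits :: "'a set \<Rightarrow> nat \<Rightarrow> (nat \<Rightarrow> 'a) \<Rightarrow> real" where
  "hits A n \<omega> = indicator A (\<omega> n)"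

definition freq :: "'a set \<Rightarrow> nat \<Rightarrow> (nat \<Rightarrow> 'a) \<Rightarrow> real" where
  "freq A m \<omega> = (\<Sum>n<m. hits A n \<omega>) / real m"

lemma hits_bounds [simp]: "0 \<le> hits A n \<omega>" "hits A n \<omega> \<le> 1" "\<bar>hits A n \<omega>\<bar> \<le> 1"
  by (auto simp: hits_def indicator_def)

lemma hits_deletion: "hits A n (deletion i \<omega>) = (if n < i then hits A n \<omega> else hits A (Suc n) \<omega>)"
  by (simp add: hits_def deletion_def)

lemma freq_bound: "\<bar>freq A m \<omega>\<bar> \<le> 1"
proof -
  have "\<bar>\<Sum>n<m. hits A n \<omega>\<bar> \<le> (\<Sum>n<m. 1)"
    by (rule order_trans[OF sum_abs sum_mono]) auto
  \<comment> \<open>For \<open>m = 0\<close> division by zero makes the frequency 0.\<close>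
  then show ?thesis by (cases "m = 0") (auto simp: freq_def abs_divide)
qed

text \<open>If \<open>i < m\<close>, the first \<open>m\<close> coordinates after the deletion are
  the old coordinates 0 to \<open>m\<close> without \<open>i\<close>: one hit is exchanged for
  another. If \<open>m \<le> i\<close>, nothing changes. For \<open>m = 0\<close> both sides are
  0.\<close>

lemma freq_deletion_bound: "\<bar>freq A m (deletion i \<omega>) - freq A m \<omega>\<bar> \<le> 1 / real m"
proof -
  have "(\<Sum>n<m. hits A n (deletion i \<omega>)) - (\<Sum>n<m. hits A n \<omega>) =
      (if m \<le> i then 0 else hits A m \<omega> - hits A i \<omega>)"
    by (induction m) (auto simp: hits_deletion not_le le_less_Suc_eq split: if_splits)
  then have "freq A m (deletion i \<omega>) - freq A m \<omega> =
      (if m \<le> i then 0 else hits A m \<omega> - hits A i \<omega>) / real m"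
    by (simp add: freq_def flip: diff_divide_distrib)
  moreover have "\<bar>if m \<le> i then 0 else hits A m \<omega> - hits A i \<omega>\<bar> \<le> 1"
    by (auto simp: hits_def indicator_def)
  ultimately show ?thesis by (simp add: abs_divide divide_right_mono)
qed

section \<open>First and second moments under deletion invariance\<close>

locale deletion_invariant_space = prob_space \<mu>
  for M :: "'a measure" and \<mu> :: "(nat \<Rightarrow> 'a) measure" +
  assumes sets_eq: "sets \<mu> = sets (seq_space M)"
    and invariant: "deletion_invariant M \<mu>"
begin

lemma deletion_measurable [measurable]: "deletion i \<in> \<mu> \<rightarrow>\<^sub>M \<mu>"
  using measurable_deletion by (simp add: measurable_cong_sets[OF sets_eq sets_eq])

lemma distr_deletion: "distr \<mu> \<mu> (deletion i) = \<mu>"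
proof (rule measure_eqI)
  fix E assume "E \<in> sets (distr \<mu> \<mu> (deletion i))"
  then show "emeasure (distr \<mu> \<mu> (deletion i)) E = emeasure \<mu> E"
    using invariant sets_eq_imp_space_eq[OF sets_eq]
    by (subst emeasure_distr) (auto simp: deletion_invariant_def sets_eq)
qed simp

lemma expectation_deletion:
  fixes g :: "(nat \<Rightarrow> 'a) \<Rightarrow> real"
  assumes [measurable]: "g \<in> borel_measurable \<mu>"
  shows "expectation (\<lambda>\<omega>. g (deletion i \<omega>)) = expectation g"
proof -
  have "expectation g = integral\<^sup>L (distr \<mu> \<mu> (deletion i)) g"
    by (simp add: distr_deletion)
  also have "\<dots> = expectation (\<lambda>\<omega>. g (deletion i \<omega>))"
    by (rule integral_distr) measurable
  finally show ?thesis ..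
qed

lemma coordinate_measurable [measurable]: "(\<lambda>\<omega>. \<omega> n) \<in> \<mu> \<rightarrow>\<^sub>M M"
  using measurable_component_singleton[of n UNIV "\<lambda>_. M"]
  by (simp add: measurable_cong_sets[OF sets_eq refl] seq_space_def)

lemma hits_measurable [measurable]:
  assumes [measurable]: "A \<in> sets M"
  shows "hits A n \<in> borel_measurable \<mu>"
  unfolding hits_def[abs_def] by measurable

lemma freq_measurable [measurable]:
  assumes [measurable]: "A \<in> sets M"
  shows "freq A n \<in> borel_measurable \<mu>"
  unfolding freq_def[abs_def] by measurable

lemma integrable_bounded:
  fixes g :: "(nat \<Rightarrow> 'a) \<Rightarrow> real"
  assumes "g \<in> borel_measurable \<mu>" "\<And>\<omega>. \<bar>g \<omega>\<bar> \<le> B"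
  shows "integrable \<mu> g"
  using assms by (intro integrable_const_bound[of _ B]) auto

text \<open>The condition on \<open>g\<close> holds in particular if \<open>g\<close> depends only
  on coordinates below \<open>k\<close>. Deleting coordinate \<open>k\<close> then fixes
  \<open>g\<close> and moves a hit at \<open>n \<ge> k\<close> to \<open>Suc n\<close>, while the
  expectation is preserved.\<close>

lemma expectation_hits_tail:
  assumes [measurable]: "A \<in> sets M" "g \<in> borel_measurable \<mu>"
    and g: "\<And>\<omega>. g (deletion k \<omega>) = g \<omega>" and "k \<le> n"
  shows "expectation (\<lambda>\<omega>. g \<omega> * hits A n \<omega>) = expectation (\<lambda>\<omega>. g \<omega> * hits A k \<omega>)"
  using \<open>k \<le> n\<close>
proof (induction n rule: dec_induct)
  case (step n)
  have "expectation (\<lambda>\<omega>. g \<omega> * hits A n \<omega>) =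
      expectation (\<lambda>\<omega>. g (deletion k \<omega>) * hits A n (deletion k \<omega>))"
    by (rule expectation_deletion[symmetric]) measurable
  also have "\<dots> = expectation (\<lambda>\<omega>. g \<omega> * hits A (Suc n) \<omega>)"
    using step.hyps by (simp add: g hits_deletion)
  finally show ?case using step.IH by simp
qed simp

lemma expectation_hits:
  assumes "A \<in> sets M"
  shows "expectation (hits A n) = expectation (hits A 0)"
  using expectation_hits_tail[OF assms, of "\<lambda>_. 1" 0 n] by simp

text \<open>Two moves reach every pair: deleting coordinate 0 shifts an adjacent pair by one, and
  deleting coordinate \<open>Suc m\<close> pushes the second index away while the first stays at
  \<open>m\<close>.\<close>

lemma expectation_hits_pair:
  assumes A [measurable]: "A \<in> sets M" and "m < n"
  shows "expectation (\<lambda>\<omega>. hits A m \<omega> * hits A n \<omega>) = expectation (\<lambda>\<omega>. hits A 0 \<omega> * hits A 1 \<omega>)"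
proof -
  have shift: "expectation (\<lambda>\<omega>. hits A m \<omega> * hits A (Suc m) \<omega>) =
      expectation (\<lambda>\<omega>. hits A 0 \<omega> * hits A 1 \<omega>)" for m
  proof (induction m)
    case (Suc m)
    have "expectation (\<lambda>\<omega>. hits A m \<omega> * hits A (Suc m) \<omega>) =
        expectation (\<lambda>\<omega>. hits A m (deletion 0 \<omega>) * hits A (Suc m) (deletion 0 \<omega>))"
      by (rule expectation_deletion[symmetric]) measurable
    then show ?case using Suc by (simp add: hits_deletion)
  qed simp
  show ?thesis
    using expectation_hits_tail[OF A hits_measurable[OF A, of m], of "Suc m" n] \<open>m < n\<close> shift[of m]
    by (simp add: hits_deletion)
qed

text \<open>The matrix of second moments has \<open>p\<close> on the diagonal, since an indicator
  equals its square, and \<open>c\<close> elsewhere. It is therefore \<open>c\<close> times the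
  all-ones matrix plus \<open>p - c\<close> times the identity, and the right-hand side is its
  quadratic form at \<open>a\<close>.\<close>

lemma expectation_square_combination:
  assumes A [measurable]: "A \<in> sets M"
  defines "p \<equiv> expectation (hits A 0)"
    and "c \<equiv> expectation (\<lambda>\<omega>. hits A 0 \<omega> * hits A 1 \<omega>)"
  shows "expectation (\<lambda>\<omega>. (\<Sum>n<N. a n * hits A n \<omega>)\<^sup>2) =
    c * (\<Sum>n<N. a n)\<^sup>2 + (p - c) * (\<Sum>n<N. (a n)\<^sup>2)"
proof -
  have prod: "expectation (\<lambda>\<omega>. hits A m \<omega> * hits A n \<omega>) = c + (if m = n then p - c else 0)" for m n
  proof (cases m n rule: linorder_cases)
    case less
    then show ?thesis using expectation_hits_pair[OF A, of m n] by (simp add: c_def)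
  next
    case equal
    have "(\<lambda>\<omega>. hits A n \<omega> * hits A n \<omega>) = hits A n"
      by (auto simp: hits_def indicator_def)
    then show ?thesis using equal expectation_hits[OF A, of n] by (simp only: p_def) simp
  next
    case greater
    then show ?thesis using expectation_hits_pair[OF A, of n m] by (simp add: c_def mult.commute)
  qed
  have int: "integrable \<mu> (\<lambda>\<omega>. hits A m \<omega> * hits A n \<omega>)" for m n
    by (rule integrable_bounded[of _ 1]) (auto simp: abs_mult intro!: mult_le_one)
  have "expectation (\<lambda>\<omega>. (\<Sum>n<N. a n * hits A n \<omega>)\<^sup>2) =
      expectation (\<lambda>\<omega>. \<Sum>m<N. \<Sum>n<N. a m * a n * (hits A m \<omega> * hits A n \<omega>))"
    by (simp add: power2_eq_square sum_product mult_ac)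
  also have "\<dots> = (\<Sum>m<N. \<Sum>n<N. a m * a n * expectation (\<lambda>\<omega>. hits A m \<omega> * hits A n \<omega>))"
    using int by (simp add: Bochner_Integration.integral_sum)
  also have "\<dots> = (\<Sum>m<N. \<Sum>n<N. c * (a m * a n) + (if m = n then (p - c) * (a m * a n) else 0))"
    unfolding prod by (intro sum.cong) (auto simp: algebra_simps)
  also have "\<dots> = c * (\<Sum>n<N. a n)\<^sup>2 + (p - c) * (\<Sum>n<N. (a n)\<^sup>2)"
    by (simp add: sum.distrib power2_eq_square flip: sum_distrib_left sum_distrib_right)
  finally show ?thesis .
qed

text \<open>The difference of the two averages is a combination of hits whose weights sum to 0, so
  only the term with the sum of squared weights survives. This bounds the L2 norm, which dominates
  the L1 norm.\<close>

lemma freq_L1_distance: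
  assumes A [measurable]: "A \<in> sets M" and "0 < m" "m \<le> N"
  shows "expectation (\<lambda>\<omega>. \<bar>freq A N \<omega> - freq A m \<omega>\<bar>) \<le> sqrt (1 / m)"
proof -
  define p where "p = expectation (hits A 0)"
  define c where "c = expectation (\<lambda>\<omega>. hits A 0 \<omega> * hits A 1 \<omega>)"
  define a where "a n = 1 / real N - (if n < m then 1 / real m else 0)" for n
  let ?D = "\<lambda>\<omega>. freq A N \<omega> - freq A m \<omega>"
  have split: "(\<Sum>n<N. if n < m then g n else 0) = (\<Sum>n<m. g n)" for g :: "nat \<Rightarrow> real"
    using \<open>m \<le> N\<close> by (intro sum.mono_neutral_cong_right) auto
  have D: "?D \<omega> = (\<Sum>n<N. a n * hits A n \<omega>)" for \<omega>
  proof -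
    have "(\<Sum>n<N. a n * hits A n \<omega>) =
        (\<Sum>n<N. hits A n \<omega> / N) - (\<Sum>n<N. if n < m then hits A n \<omega> / m else 0)"
      unfolding a_def by (subst sum_subtractf[symmetric], intro sum.cong) (auto simp: algebra_simps)
    then show ?thesis by (simp add: split freq_def sum_divide_distrib)
  qed
  have a0: "(\<Sum>n<N. a n) = 0"
    using assms by (simp add: a_def sum_subtractf split)
  \<comment> \<open>Expanding the square for \<open>n < m\<close> separates a constant part, with
    total 1/N, from a part supported on \<open>n < m\<close>, with total 1/m - 2/N.\<close>
  have "(\<Sum>n<N. (a n)\<^sup>2) =
      (\<Sum>n<N. (1 / real N)\<^sup>2 + (if n < m then (1 / real m)\<^sup>2 - 2 / (real N * real m) else 0))"
    using assms by (intro sum.cong) (auto simp: a_def power2_eq_square field_simps)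
  also have "\<dots> = 1 / m - 1 / N"
    using assms by (simp only: sum.distrib split) (simp add: power2_eq_square field_simps)
  also have "\<dots> \<le> 1 / m" by simp
  finally have a2: "(\<Sum>n<N. (a n)\<^sup>2) \<le> 1 / m" .
  have int: "integrable \<mu> (\<lambda>\<omega>. \<bar>?D \<omega>\<bar>)" "integrable \<mu> (\<lambda>\<omega>. (?D \<omega>)\<^sup>2)"
  proof -
    have *: "\<bar>?D \<omega>\<bar> \<le> 2" for \<omega>
      using freq_bound[of A N \<omega>] freq_bound[of A m \<omega>] by linarith
    then have "(?D \<omega>)\<^sup>2 \<le> 2\<^sup>2" for \<omega>
      by (metis abs_ge_zero power2_abs power_mono)
    then show "integrable \<mu> (\<lambda>\<omega>. (?D \<omega>)\<^sup>2)"
      by (intro integrable_bounded[of _ 4]) auto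
    show "integrable \<mu> (\<lambda>\<omega>. \<bar>?D \<omega>\<bar>)"
      using * by (intro integrable_bounded[of _ 2]) auto
  qed
  \<comment> \<open>Nonnegativity of the variance of the absolute difference plays the role of
    Cauchy-Schwarz.\<close>
  have "(expectation (\<lambda>\<omega>. \<bar>?D \<omega>\<bar>))\<^sup>2 \<le> expectation (\<lambda>\<omega>. \<bar>?D \<omega>\<bar>\<^sup>2)"
    using variance_positive[of "\<lambda>\<omega>. \<bar>?D \<omega>\<bar>"] int by (subst (asm) variance_eq) auto
  also have "\<dots> = (p - c) * (\<Sum>n<N. (a n)\<^sup>2)"
    using expectation_square_combination[OF A, where N = N and a = a]
    unfolding p_def[symmetric] c_def[symmetric] by (simp add: D a0)
  also have "\<dots> \<le> 1 * (1 / m)"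
  proof (intro mult_mono a2 sum_nonneg)
    have "p \<le> 1" unfolding p_def
      by (intro integral_le_const integrable_bounded[of _ 1]) auto
    moreover have "0 \<le> c" unfolding c_def
      by (intro integral_nonneg_AE) auto
    ultimately show "p - c \<le> 1" by simp
  qed auto
  finally show ?thesis by (intro real_le_rsqrt) simp
qed

section \<open>Almost sure limit of the frequencies and its integrals\<close>

text \<open>
  Where the limit fails to exist, \<open>lim\<close> is an unspecified value that depends only on the set of
  limits of the sequence. This makes \<open>limit_freq A\<close> strictly, not just almost surely,
  deletion invariant, as \<open>deletion_ergodic\<close> requires.
\<close>

definition limit_freq :: "'a set \<Rightarrow> (nat \<Rightarrow> 'a) \<Rightarrow> real" where
  "limit_freq A \<omega> = lim (\<lambda>j. freq A (4 ^ j) \<omega>)"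

lemma limit_freq_measurable [measurable]:
  assumes [measurable]: "A \<in> sets M"
  shows "limit_freq A \<in> borel_measurable \<mu>"
  unfolding limit_freq_def[abs_def] by measurable

lemma limit_freq_deletion: "limit_freq A (deletion i \<omega>) = limit_freq A \<omega>"
  unfolding limit_freq_def
proof (intro lim_cong_diff_tendsto_zero)
  have "(\<lambda>j. 1 / real (4 ^ j)) \<longlonglongrightarrow> 0"
    using LIMSEQ_power_zero[of "1 / 4 :: real"] by (simp add: power_one_over)
  then show "(\<lambda>j. freq A (4 ^ j) (deletion i \<omega>) - freq A (4 ^ j) \<omega>) \<longlonglongrightarrow> 0"
    by (rule Lim_null_comparison[rotated])
      (use freq_deletion_bound[of A "4 ^ _" i \<omega>] in \<open>auto intro!: always_eventually\<close>)
qed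

text \<open>The growth rate 4 turns the L1 bound \<open>sqrt (1 / m)\<close> at
  \<open>m = 4 ^ j\<close> into \<open>(1 / 2) ^ j\<close>, which is summable.\<close>

lemma freq_AE_tendsto:
  assumes A [measurable]: "A \<in> sets M"
  shows "AE \<omega> in \<mu>. (\<lambda>j. freq A (4 ^ j) \<omega>) \<longlonglongrightarrow> limit_freq A \<omega>"
proof -
  have "AE \<omega> in \<mu>. convergent (\<lambda>j. freq A (4 ^ j) \<omega>)"
  proof (rule AE_convergent_if_summable_L1)
    show "integrable \<mu> (freq A (4 ^ j))" for j
      using freq_bound by (intro integrable_bounded[of _ 1]) auto
    have "expectation (\<lambda>\<omega>. \<bar>freq A (4 ^ Suc j) \<omega> - freq A (4 ^ j) \<omega>\<bar>) \<le> (1 / 2) ^ j" for j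
    proof -
      have "sqrt (1 / real (4 ^ j)) = (1 / 2) ^ j"
        by (rule real_sqrt_unique) (auto simp: power_one_over power2_eq_square simp flip: power_mult_distrib)
      then show ?thesis using freq_L1_distance[OF A, of "4 ^ j" "4 ^ Suc j"] by simp
    qed
    then show "summable (\<lambda>j. expectation (\<lambda>\<omega>. \<bar>freq A (4 ^ Suc j) \<omega> - freq A (4 ^ j) \<omega>\<bar>))"
      by (intro summable_comparison_test'[OF summable_geometric[of "1 / 2 :: real"]]) auto
  qed
  then show ?thesis
    by eventually_elim (simp add: limit_freq_def convergent_LIMSEQ_iff)
qed

text \<open>The left side is the Cesaro average of the numbers \<open>?e n\<close>, which are
  constant from \<open>n = k\<close> on. Only the first \<open>k\<close> terms deviate, and their
  contribution divided by \<open>m\<close> vanishes.\<close>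

lemma expectation_freq_tendsto:
  assumes A [measurable]: "A \<in> sets M" and g_meas [measurable]: "g \<in> borel_measurable \<mu>"
    and g: "\<And>\<omega>. g (deletion k \<omega>) = g \<omega>" and B: "\<And>\<omega>. \<bar>g \<omega>\<bar> \<le> B"
  shows "(\<lambda>m. expectation (\<lambda>\<omega>. g \<omega> * freq A m \<omega>)) \<longlonglongrightarrow> expectation (\<lambda>\<omega>. g \<omega> * hits A k \<omega>)"
proof -
  let ?e = "\<lambda>n. expectation (\<lambda>\<omega>. g \<omega> * hits A n \<omega>)"
  have bd: "\<bar>g \<omega> * hits A n \<omega>\<bar> \<le> B" for \<omega> n
    using mult_mono[OF B[of \<omega>], of "\<bar>hits A n \<omega>\<bar>" 1] B[of \<omega>] by (simp add: abs_mult)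
  have int: "integrable \<mu> (\<lambda>\<omega>. g \<omega> * hits A n \<omega>)" for n
    by (rule integrable_bounded[OF _ bd]) measurable
  have eq: "expectation (\<lambda>\<omega>. g \<omega> * freq A m \<omega>) = (\<Sum>n<m. ?e n) / m" for m
    using int by (simp add: freq_def sum_distrib_left)
  have tail: "(\<Sum>n<m. ?e n) / m - ?e k = (\<Sum>n<k. ?e n - ?e k) / m" if "k \<le> m" "0 < m" for m
  proof -
    have "(\<Sum>n<m. ?e n - ?e k) = (\<Sum>n<k. ?e n - ?e k)"
      using that by (intro sum.mono_neutral_right) (auto intro: expectation_hits_tail[OF A g_meas g])
    then show ?thesis using that by (simp add: sum_subtractf field_simps)
  qed
  have "(\<lambda>m. (\<Sum>n<k. ?e n - ?e k) / m) \<longlonglongrightarrow> 0"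
    by (rule lim_const_over_n)
  moreover have "\<forall>\<^sub>F m in sequentially. (\<Sum>n<k. ?e n - ?e k) / m = (\<Sum>n<m. ?e n) / m - ?e k"
    \<comment> \<open>Starting at \<open>Suc k\<close> rather than \<open>k\<close> also ensures
      \<open>0 < m\<close>.\<close>
    using eventually_ge_at_top[of "Suc k"] by eventually_elim (simp add: tail)
  ultimately have "(\<lambda>m. (\<Sum>n<m. ?e n) / m - ?e k) \<longlonglongrightarrow> 0"
    by (rule Lim_transform_eventually)
  then show ?thesis unfolding eq by (simp add: LIM_zero_iff)
qed

text \<open>Against such a \<open>g\<close>, the hit at \<open>k\<close> may be replaced by the
  limit frequency. Dominated convergence with bound \<open>B\<close> computes the limit along
  \<open>4 ^ j\<close> in one way, and the full sequence of averaged expectations computes it in the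
  other.\<close>

lemma expectation_mult_limit_freq:
  assumes A [measurable]: "A \<in> sets M" and g_meas [measurable]: "g \<in> borel_measurable \<mu>"
    and g: "\<And>\<omega>. g (deletion k \<omega>) = g \<omega>" and B: "\<And>\<omega>. \<bar>g \<omega>\<bar> \<le> B"
  shows "integrable \<mu> (\<lambda>\<omega>. g \<omega> * limit_freq A \<omega>)"
    and "expectation (\<lambda>\<omega>. g \<omega> * limit_freq A \<omega>) = expectation (\<lambda>\<omega>. g \<omega> * hits A k \<omega>)"
proof -
  have bd: "\<bar>g \<omega> * freq A m \<omega>\<bar> \<le> B" for \<omega> m
    using mult_mono[OF B[of \<omega>] freq_bound[of A m \<omega>]] B[of \<omega>] by (simp add: abs_mult)
  have lim: "AE \<omega> in \<mu>. (\<lambda>j. g \<omega> * freq A (4 ^ j) \<omega>) \<longlonglongrightarrow> g \<omega> * limit_freq A \<omega>"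
    using freq_AE_tendsto[OF A] by eventually_elim (intro tendsto_mult tendsto_const)
  show "integrable \<mu> (\<lambda>\<omega>. g \<omega> * limit_freq A \<omega>)"
    by (rule integrable_dominated_convergence[OF _ _ _ lim, where w = "\<lambda>_. B"]) (use bd in auto)
  have "(\<lambda>j. expectation (\<lambda>\<omega>. g \<omega> * freq A (4 ^ j) \<omega>)) \<longlonglongrightarrow> expectation (\<lambda>\<omega>. g \<omega> * limit_freq A \<omega>)"
    by (rule integral_dominated_convergence[OF _ _ _ lim, where w = "\<lambda>_. B"]) (use bd in auto)
  moreover have "(\<lambda>j. expectation (\<lambda>\<omega>. g \<omega> * freq A (4 ^ j) \<omega>)) \<longlonglongrightarrow> expectation (\<lambda>\<omega>. g \<omega> * hits A k \<omega>)"
    using LIMSEQ_subseq_LIMSEQ[OF expectation_freq_tendsto[OF assms], of "\<lambda>j. 4 ^ j"]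
    by (simp add: o_def strict_mono_def)
  ultimately show "expectation (\<lambda>\<omega>. g \<omega> * limit_freq A \<omega>) = expectation (\<lambda>\<omega>. g \<omega> * hits A k \<omega>)"
    by (rule LIMSEQ_unique)
qed

section \<open>Ergodicity and factorisation of expectations\<close>

lemma limit_freq_AE_const:
  assumes A [measurable]: "A \<in> sets M" and erg: "deletion_ergodic M \<mu>"
  shows "AE \<omega> in \<mu>. limit_freq A \<omega> = expectation (hits A 0)"
proof -
  \<comment> \<open>The case of constant \<open>g = 1\<close> and \<open>k = 0\<close> identifies
    the mean of the limit frequency.\<close>
  have int: "integrable \<mu> (limit_freq A)" and e: "expectation (limit_freq A) = expectation (hits A 0)"
    using expectation_mult_limit_freq[OF A, of "\<lambda>_. 1" 0 1] by simp_all
  have zero_one: "prob {\<omega> \<in> space \<mu>. limit_freq A \<omega> \<le> q} \<in> {0, 1}" for q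
  proof -
    let ?E = "{\<omega> \<in> space \<mu>. limit_freq A \<omega> \<le> q}"
    have sp: "space \<mu> = space (seq_space M)" by (rule sets_eq_imp_space_eq[OF sets_eq])
    have "?E \<in> sets \<mu>" by measurable
    \<comment> \<open>Invariance holds as an equality of sets because
      \<open>limit_freq_deletion\<close> holds at every point, including those where the frequencies
      diverge.\<close>
    moreover have "deletion i -` ?E \<inter> space (seq_space M) = ?E" for i
      using measurable_space[OF measurable_deletion[of i M]] by (auto simp: sp limit_freq_deletion)
    ultimately have "emeasure \<mu> ?E \<in> {0, 1}"
      using erg unfolding deletion_ergodic_def sets_eq by blast
    then show ?thesis by (auto simp: measure_def)
  qed
  show ?thesis
    using AE_eq_expectation_if_zero_one[OF int zero_one] by (simp add: e)
qed

text \<open>Once the hit is replaced by the limit frequency, that factor is almost surely constant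
  and leaves the integral.\<close>

lemma expectation_mult_hits:
  assumes A [measurable]: "A \<in> sets M" and erg: "deletion_ergodic M \<mu>"
    and g_meas [measurable]: "g \<in> borel_measurable \<mu>"
    and g: "\<And>\<omega>. g (deletion k \<omega>) = g \<omega>" and B: "\<And>\<omega>. \<bar>g \<omega>\<bar> \<le> B"
  shows "expectation (\<lambda>\<omega>. g \<omega> * hits A k \<omega>) = expectation g * expectation (hits A 0)"
proof -
  have "expectation (\<lambda>\<omega>. g \<omega> * hits A k \<omega>) = expectation (\<lambda>\<omega>. g \<omega> * limit_freq A \<omega>)"
    by (rule expectation_mult_limit_freq(2)[OF A g_meas g B, symmetric])
  also have "\<dots> = expectation (\<lambda>\<omega>. g \<omega> * expectation (hits A 0))"
    using limit_freq_AE_const[OF A erg] by (intro integral_cong_AE) auto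
  finally show ?thesis by simp
qed

text \<open>In the induction, the product over \<open>i < k\<close> sees only coordinates below
  \<open>k\<close>, so deleting coordinate \<open>k\<close> does not affect it and the next factor
  splits off.\<close>

lemma expectation_prod_hits:
  assumes A: "\<And>i. A i \<in> sets M" and erg: "deletion_ergodic M \<mu>"
  shows "expectation (\<lambda>\<omega>. \<Prod>i<k. hits (A i) i \<omega>) = (\<Prod>i<k. expectation (hits (A i) 0))"
proof (induction k)
  case (Suc k)
  have [measurable]: "hits (A i) n \<in> borel_measurable \<mu>" for i n
    using A by measurable
  have "expectation (\<lambda>\<omega>. (\<Prod>i<k. hits (A i) i \<omega>) * hits (A k) k \<omega>) =
      expectation (\<lambda>\<omega>. \<Prod>i<k. hits (A i) i \<omega>) * expectation (hits (A k) 0)"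
    by (rule expectation_mult_hits[OF A erg, where B = 1])
      (auto simp: hits_deletion abs_prod intro!: prod_le_1)
  then show ?case using Suc by simp
qed (simp add: prob_space)

section \<open>Identification with the product measure\<close>

lemma measure_eq_product:
  assumes erg: "deletion_ergodic M \<mu>"
  shows "\<mu> = (\<Pi>\<^sub>M n\<in>UNIV. distr \<mu> M (\<lambda>\<omega>. \<omega> 0))"
proof -
  define \<eta> where "\<eta> = distr \<mu> M (\<lambda>\<omega>. \<omega> 0)"
  have sets_\<eta> [simp]: "sets \<eta> = sets M" and space_\<eta>: "space \<eta> = space M" by (auto simp: \<eta>_def)
  interpret \<eta>: prob_space \<eta> unfolding \<eta>_def by (rule prob_space_distr) measurable
  interpret P: product_prob_space "\<lambda>_::nat. \<eta>" UNIV ..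
  have sp: "space \<mu> = space (Pi\<^sub>M UNIV (\<lambda>_. M))"
    using sets_eq_imp_space_eq[OF sets_eq] by (simp add: seq_space_def)
  have \<eta>_eq: "expectation (hits A 0) = measure \<eta> A" if [measurable]: "A \<in> sets M" for A
  proof -
    have "measure \<eta> A = integral\<^sup>L \<eta> (indicator A)" using that by simp
    also have "\<dots> = expectation (\<lambda>\<omega>. indicator A (\<omega> 0))"
      unfolding \<eta>_def by (rule integral_distr) measurable
    finally show ?thesis by (simp add: hits_def[abs_def])
  qed
  have "\<mu> = Pi\<^sub>M UNIV (\<lambda>_. \<eta>)"
  proof (rule P.PiM_eq)
    show sets_\<mu>: "sets \<mu> = sets (Pi\<^sub>M UNIV (\<lambda>_. \<eta>))"
      unfolding sets_eq seq_space_def by (rule sets_PiM_cong) auto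
    fix J :: "nat set" and F :: "nat \<Rightarrow> 'a set"
    assume J: "finite J" "J \<subseteq> UNIV" and F: "\<And>j. j \<in> J \<Longrightarrow> F j \<in> sets \<eta>"
    obtain k where k: "J \<subseteq> {..<k}" using J(1) finite_nat_iff_bounded by blast
    \<comment> \<open>The finite index set \<open>J\<close> is padded to an initial segment by
      unconstrained coordinates, so that the product formula for \<open>i < k\<close> applies to the
      cylinder.\<close>
    define A where "A i = (if i \<in> J then F i else space M)" for i
    have A [measurable]: "A i \<in> sets M" for i using F by (auto simp: A_def)
    let ?E = "P.emb UNIV J (Pi\<^sub>E J F)"
    have E_iff: "\<omega> \<in> ?E \<longleftrightarrow> (\<forall>i<k. \<omega> i \<in> A i)" if "\<omega> \<in> space \<mu>" for \<omega>
      using that k by (auto simp: prod_emb_def A_def sp space_\<eta> space_PiM PiE_iff)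
    have E [measurable]: "?E \<in> sets \<mu>"
      unfolding sets_\<mu> using J F by (intro sets_PiM_I) auto
    have "(\<Prod>i<k. hits (A i) i \<omega>) = indicator ?E \<omega>" if "\<omega> \<in> space \<mu>" for \<omega>
      using E_iff[OF that] by (cases "\<omega> \<in> ?E") (auto simp: hits_def indicator_def intro!: prod.neutral)
    then have "measure \<mu> ?E = expectation (\<lambda>\<omega>. \<Prod>i<k. hits (A i) i \<omega>)"
      using E by (simp cong: Bochner_Integration.integral_cong)
    also have "\<dots> = (\<Prod>i<k. measure \<eta> (A i))"
      using A \<eta>_eq by (simp add: expectation_prod_hits[OF A erg])
    \<comment> \<open>Each padding factor is the total mass of \<open>\<eta>\<close>, which is
      1.\<close>
    also have "\<dots> = (\<Prod>j\<in>J. measure \<eta> (F j))"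
      using k \<eta>.prob_space
      by (intro prod.mono_neutral_cong_right) (auto simp: A_def space_\<eta>)
    finally show "emeasure \<mu> ?E = (\<Prod>j\<in>J. emeasure \<eta> (F j))"
      by (simp add: emeasure_eq_measure \<eta>.emeasure_eq_measure prod_ennreal)
  qed
  then show ?thesis unfolding \<eta>_def .
qed

end

theorem proposition6p1:
  fixes M :: "'a measure" and \<mu> :: "(nat \<Rightarrow> 'a) measure"
  assumes "prob_measure_on (seq_space M) \<mu>"
    and "deletion_invariant M \<mu>"
    and "deletion_ergodic M \<mu>"
  shows "IID M \<mu>"
proof -
  interpret prob_space \<mu> using assms(1) by (simp add: prob_measure_on_def)
  interpret deletion_invariant_space M \<mu>
    by standard (use assms in \<open>auto simp: prob_measure_on_def\<close>)
  have "prob_measure_on M (distr \<mu> M (\<lambda>\<omega>. \<omega> 0))"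
    by (auto simp: prob_measure_on_def intro!: prob_space_distr)
  then show ?thesis
    unfolding IID_def using measure_eq_product[OF assms(3)] by blast
qed

end
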